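(* Let $(x_k)$ be a bibasic sequence in a Banach lattice $X$ with basis constant $K$ and bibasis constant $M$. Let $(y_k)$ be a sequence in $X$ with $$2K\sum_{k=1}^\infty\frac{\|x_k-y_k\|}{\|x_k\|}=:\theta<1.$$ Then $(y_k)$ is bibasic with bibasis constant at most $\frac{M+\theta}{1-\theta}$.
   Context: A sequence $(x_k)$ of non-zero vectors in a Banach space is Schauder basic iff there is $K\ge1$ with $\|\sum_{k=1}^n\alpha_kx_k\|\le K\|\sum_{k=1}^m\alpha_kx_k\|$ for all $n\le m$ and all scalars; the least such $K$ is the basis constant. A sequence $(x_k)$ of non-zero vectors in a Banach lattice is bibasic if there is $M\ge1$ such that for all $m\in\mathbb N$ and all scalars $\alpha_1,\dots,\alpha_m$ one has $\bigl\|\bigvee_{n=1}^m|\sum_{k=1}^n\alpha_kx_k|\bigr\|\le M\bigl\|\sum_{k=1}^m\alpha_kx_k\bigr\|$ (the bibasis inequality; such a sequence is automatically Schauder basic); the least such $M$ is the bibasis constant of $(x_k)$. *)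

theory Defs
  imports "HOL-Analysis.Analysis" "HOL-Library.Lattice_Algebras"
begin

text \<open>
  Real Banach lattices: a vector lattice with modulus \<open>\<bar>x\<bar> = sup x (- x)\<close> (this is the
  axiom of \<^class>\<open>lattice_ab_group_add_abs\<close>) and a complete lattice norm.
\<close>

class banach_lattice = banach + ordered_real_vector + lattice_ab_group_add_abs +
  assumes norm_mono_abs: "\<bar>x\<bar> \<le> \<bar>y\<bar> \<Longrightarrow> norm x \<le> norm y"

instance real :: banach_lattice
  by standard (auto simp: abs_real_def sup_real_def)

text \<open>
  Sequences are indexed from \<open>0\<close>, so \<open>x k\<close> is the vector \<open>x\<^sub>k\<^sub>+\<^sub>1\<close> of the usual notation and
  \<open>\<Sum>k<n. \<alpha> k *\<^sub>R x k\<close> is the sum of the first \<open>n\<close> terms.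
\<close>

definition basis_bound :: "(nat \<Rightarrow> 'a::banach) \<Rightarrow> real \<Rightarrow> bool" where
  "basis_bound x K \<longleftrightarrow> K \<ge> 1 \<and>
     (\<forall>(\<alpha> :: nat \<Rightarrow> real) n m. n \<le> m \<longrightarrow>
        norm (\<Sum>k<n. \<alpha> k *\<^sub>R x k) \<le> K * norm (\<Sum>k<m. \<alpha> k *\<^sub>R x k))"

definition schauder_basic :: "(nat \<Rightarrow> 'a::banach) \<Rightarrow> bool" where
  "schauder_basic x \<longleftrightarrow> (\<forall>k. x k \<noteq> 0) \<and> (\<exists>K. basis_bound x K)"

definition basis_constant :: "(nat \<Rightarrow> 'a::banach) \<Rightarrow> real" where
  "basis_constant x = (LEAST K. basis_bound x K)"

definition bibasis_bound :: "(nat \<Rightarrow> 'a::banach_lattice) \<Rightarrow> real \<Rightarrow> bool" where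
  "bibasis_bound x M \<longleftrightarrow> M \<ge> 1 \<and>
     (\<forall>(\<alpha> :: nat \<Rightarrow> real) m. m \<ge> 1 \<longrightarrow>
        norm (Sup_fin ((\<lambda>n. \<bar>\<Sum>k<n. \<alpha> k *\<^sub>R x k\<bar>) ` {1..m}))
          \<le> M * norm (\<Sum>k<m. \<alpha> k *\<^sub>R x k))"

definition bibasic :: "(nat \<Rightarrow> 'a::banach_lattice) \<Rightarrow> bool" where
  "bibasic x \<longleftrightarrow> (\<forall>k. x k \<noteq> 0) \<and> (\<exists>M. bibasis_bound x M)"

definition bibasis_constant :: "(nat \<Rightarrow> 'a::banach_lattice) \<Rightarrow> real" where
  "bibasis_constant x = (LEAST M. bibasis_bound x M)"

text \<open>The least constants exist, so \<^const>\<open>Least\<close> is used on its intended domain.\<close>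

lemma Least_bound_attained:
  fixes a b :: "'i \<Rightarrow> real" and P :: "real \<Rightarrow> bool"
  assumes P: "\<And>c. P c \<longleftrightarrow> c \<ge> 1 \<and> (\<forall>i. Q i \<longrightarrow> a i \<le> c * b i)"
    and b: "\<And>i. b i \<ge> 0" and ex: "P c0"
  shows "P (Least P)" and "P c \<Longrightarrow> Least P \<le> c"
proof -
  define I where "I = Inf {c. P c}"
  have bdd: "bdd_below {c. P c}"
    using P by (intro bdd_belowI[of _ 1]) auto
  have lower: "I \<le> d" if "P d" for d
    unfolding I_def using that bdd by (intro cInf_lower) auto
  have great: "d \<le> I" if "\<And>c. P c \<Longrightarrow> d \<le> c" for d
    unfolding I_def using that ex by (intro cInf_greatest) auto
  have "a i \<le> I * b i" if "Q i" for i
  proof (cases "b i = 0")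
    case True
    then show ?thesis using ex P that by fastforce
  next
    case False
    then have pos: "b i > 0" using b[of i] by linarith
    have "a i / b i \<le> I"
    proof (rule great)
      fix c assume "P c"
      then show "a i / b i \<le> c" using P that pos by (simp add: pos_divide_le_eq)
    qed
    then show ?thesis using pos by (simp add: pos_divide_le_eq)
  qed
  moreover have "1 \<le> I" using P by (intro great) auto
  ultimately have PI: "P I" using P by blast
  have "Least P = I" by (rule Least_equality) (use PI lower in auto)
  then show "P (Least P)" and "P c \<Longrightarrow> Least P \<le> c" using PI lower by auto
qed

lemma basis_constant_attained:
  assumes "schauder_basic x"
  shows "basis_bound x (basis_constant x)" and "basis_bound x K \<Longrightarrow> basis_constant x \<le> K"
proof -
  obtain K0 where K0: "basis_bound x K0" using assms by (auto simp: schauder_basic_def)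
  let ?Q = "\<lambda>(\<alpha> :: nat \<Rightarrow> real, n :: nat, m). n \<le> m"
  let ?a = "\<lambda>(\<alpha> :: nat \<Rightarrow> real, n :: nat, m :: nat). norm (\<Sum>k<n. \<alpha> k *\<^sub>R x k)"
  let ?b = "\<lambda>(\<alpha> :: nat \<Rightarrow> real, n :: nat, m :: nat). norm (\<Sum>k<m. \<alpha> k *\<^sub>R x k)"
  have P: "basis_bound x c \<longleftrightarrow> c \<ge> 1 \<and> (\<forall>i. ?Q i \<longrightarrow> ?a i \<le> c * ?b i)" for c
    by (auto simp: basis_bound_def)
  have b: "?b i \<ge> 0" for i
    by (auto split: prod.split)
  show "basis_bound x (basis_constant x)"
    unfolding basis_constant_def by (rule Least_bound_attained(1)[OF P b K0])
  show "basis_constant x \<le> K" if "basis_bound x K"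
    unfolding basis_constant_def by (rule Least_bound_attained(2)[OF P b K0 that])
qed

lemma bibasis_constant_attained:
  assumes "bibasic x"
  shows "bibasis_bound x (bibasis_constant x)"
    and "bibasis_bound x M \<Longrightarrow> bibasis_constant x \<le> M"
proof -
  obtain M0 where M0: "bibasis_bound x M0" using assms by (auto simp: bibasic_def)
  let ?Q = "\<lambda>(\<alpha> :: nat \<Rightarrow> real, m :: nat). m \<ge> 1"
  let ?a = "\<lambda>(\<alpha> :: nat \<Rightarrow> real, m :: nat).
      norm (Sup_fin ((\<lambda>n. \<bar>\<Sum>k<n. \<alpha> k *\<^sub>R x k\<bar>) ` {1..m}))"
  let ?b = "\<lambda>(\<alpha> :: nat \<Rightarrow> real, m :: nat). norm (\<Sum>k<m. \<alpha> k *\<^sub>R x k)"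
  have P: "bibasis_bound x c \<longleftrightarrow> c \<ge> 1 \<and> (\<forall>i. ?Q i \<longrightarrow> ?a i \<le> c * ?b i)" for c
    by (auto simp: bibasis_bound_def)
  have b: "?b i \<ge> 0" for i
    by (auto split: prod.split)
  show "bibasis_bound x (bibasis_constant x)"
    unfolding bibasis_constant_def by (rule Least_bound_attained(1)[OF P b M0])
  show "bibasis_constant x \<le> M" if "bibasis_bound x M"
    unfolding bibasis_constant_def by (rule Least_bound_attained(2)[OF P b M0 that])
qed

lemma bibasic_imp_schauder_basic:
  assumes "bibasic x"
  shows "schauder_basic x"
proof -
  obtain M where M: "M \<ge> 1" and
    le: "\<And>\<alpha> m. m \<ge> 1 \<Longrightarrow> norm (Sup_fin ((\<lambda>n. \<bar>\<Sum>k<n. \<alpha> k *\<^sub>R x k\<bar>) ` {1..m}))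
          \<le> M * norm (\<Sum>k<m. \<alpha> k *\<^sub>R x k)"
    using assms by (auto simp: bibasic_def bibasis_bound_def)
  have "norm (\<Sum>k<n. \<alpha> k *\<^sub>R x k) \<le> M * norm (\<Sum>k<m. \<alpha> k *\<^sub>R x k)" if "n \<le> m" for \<alpha> n m
  proof (cases "n = 0")
    case True
    then show ?thesis using M by simp
  next
    case False
    let ?S = "Sup_fin ((\<lambda>n. \<bar>\<Sum>k<n. \<alpha> k *\<^sub>R x k\<bar>) ` {1..m})"
    have "\<bar>\<Sum>k<n. \<alpha> k *\<^sub>R x k\<bar> \<le> ?S"
      using False that by (intro Sup_fin.coboundedI) auto
    moreover from this have "?S \<le> \<bar>?S\<bar>"
      by (simp add: abs_lattice)
    ultimately have "norm (\<Sum>k<n. \<alpha> k *\<^sub>R x k) \<le> norm ?S"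
      by (intro norm_mono_abs) (rule order_trans)
    also have "\<dots> \<le> M * norm (\<Sum>k<m. \<alpha> k *\<^sub>R x k)"
      using False that by (intro le) auto
    finally show ?thesis .
  qed
  then have "basis_bound x M" using M by (auto simp: basis_bound_def)
  then show ?thesis using assms by (auto simp: schauder_basic_def bibasic_def)
qed

end

theory Submission imports Defs begin

text \<open>
  Since \<open>\<bar>\<alpha>\<^sub>k\<bar> \<parallel>x\<^sub>k\<parallel> \<le> 2K \<parallel>\<Sum>\<^sub>k\<^sub><\<^sub>m \<alpha>\<^sub>k x\<^sub>k\<parallel>\<close>, the vector \<open>Z = \<Sum>\<^sub>k\<^sub><\<^sub>m \<bar>\<alpha>\<^sub>k (x\<^sub>k - y\<^sub>k)\<bar>\<close> has norm at most
  \<open>\<theta> \<parallel>\<Sum>\<^sub>k\<^sub><\<^sub>m \<alpha>\<^sub>k x\<^sub>k\<parallel>\<close>. It dominates the difference of every pair of corresponding partial sums,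
  so replacing \<open>x\<close> by \<open>y\<close> adds at most \<open>Z\<close> to the supremum of their moduli, while
  \<open>\<parallel>\<Sum>\<^sub>k\<^sub><\<^sub>m \<alpha>\<^sub>k x\<^sub>k\<parallel> \<le> \<parallel>\<Sum>\<^sub>k\<^sub><\<^sub>m \<alpha>\<^sub>k y\<^sub>k\<parallel> / (1 - \<theta>)\<close>.
\<close>

lemma norm_abs_eq [simp]:
  fixes z :: "'a::banach_lattice"
  shows "norm \<bar>z\<bar> = norm z"
  by (intro antisym norm_mono_abs) simp_all

lemma norm_mono_nonneg:
  fixes u v :: "'a::banach_lattice"
  assumes "0 \<le> u" "u \<le> v"
  shows "norm u \<le> norm v"
  using assms by (intro norm_mono_abs) (simp add: abs_of_nonneg order_trans[OF assms])

lemma norm_sum_abs_le: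
  fixes f :: "'i \<Rightarrow> 'a::banach_lattice"
  shows "norm (\<Sum>i\<in>I. \<bar>f i\<bar>) \<le> (\<Sum>i\<in>I. norm (f i))"
  using norm_sum[of "\<lambda>i. \<bar>f i\<bar>" I] by simp

text \<open>The \<open>k\<close>-th term is the difference of two consecutive partial sums, each of
  norm at most \<open>K\<close> times that of the full sum; hence the factor 2.\<close>

lemma basis_bound_coeff_le:
  assumes "basis_bound x K" "k < m"
  shows "norm (\<alpha> k *\<^sub>R x k) \<le> 2 * K * norm (\<Sum>j<m. \<alpha> j *\<^sub>R x j)"
proof -
  have le: "norm (\<Sum>j<n. \<alpha> j *\<^sub>R x j) \<le> K * norm (\<Sum>j<m. \<alpha> j *\<^sub>R x j)" if "n \<le> m" for n
    using assms(1) that by (auto simp: basis_bound_def)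
  have "\<alpha> k *\<^sub>R x k = (\<Sum>j<Suc k. \<alpha> j *\<^sub>R x j) - (\<Sum>j<k. \<alpha> j *\<^sub>R x j)"
    by simp
  then have "norm (\<alpha> k *\<^sub>R x k) \<le> norm (\<Sum>j<Suc k. \<alpha> j *\<^sub>R x j) + norm (\<Sum>j<k. \<alpha> j *\<^sub>R x j)"
    by (metis norm_triangle_ineq4)
  then show ?thesis
    using le[of "Suc k"] le[of k] assms(2) by linarith
qed

text \<open>As \<open>x k\<close> is nonzero, each term on the left is
  \<open>norm (\<alpha> k *\<^sub>R x k)\<close> times a relative error, and the coefficient bound
  applies termwise. Passing to the full series makes the constant independent of
  \<open>m\<close>.\<close>

lemma basis_bound_perturbation_le:
  assumes x: "basis_bound x K" "\<And>k. x k \<noteq> 0"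
    and sm: "summable (\<lambda>k. norm (x k - y k) / norm (x k))"
  shows "(\<Sum>k<m. norm (\<alpha> k *\<^sub>R (x k - y k)))
    \<le> 2 * K * (\<Sum>k. norm (x k - y k) / norm (x k)) * norm (\<Sum>k<m. \<alpha> k *\<^sub>R x k)"
proof -
  let ?r = "\<lambda>k. norm (x k - y k) / norm (x k)" and ?N = "norm (\<Sum>k<m. \<alpha> k *\<^sub>R x k)"
  have K: "K \<ge> 1" using x(1) by (simp add: basis_bound_def)
  have "norm (\<alpha> k *\<^sub>R (x k - y k)) \<le> 2 * K * ?N * ?r k" if "k < m" for k
  proof -
    have "norm (\<alpha> k *\<^sub>R (x k - y k)) = norm (\<alpha> k *\<^sub>R x k) * ?r k"
      using x(2)[of k] by simp
    also have "\<dots> \<le> 2 * K * ?N * ?r k"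
      by (intro mult_right_mono basis_bound_coeff_le[OF x(1) that]) simp
    finally show ?thesis .
  qed
  then have "(\<Sum>k<m. norm (\<alpha> k *\<^sub>R (x k - y k))) \<le> 2 * K * ?N * (\<Sum>k<m. ?r k)"
    unfolding sum_distrib_left by (intro sum_mono) simp
  also have "\<dots> \<le> 2 * K * ?N * (\<Sum>k. ?r k)"
    using K by (intro mult_left_mono sum_le_suminf sm) auto
  finally show ?thesis by (simp add: ac_simps)
qed

text \<open>The basis constant is hidden in \<open>pert\<close>, which serves twice: it bounds the
  norm of the dominating vector \<open>Z\<close>, and it compares the full sums of \<open>x\<close>
  and \<open>y\<close>.\<close>

lemma bibasis_bound_perturb:
  fixes x y :: "nat \<Rightarrow> 'a::banach_lattice"
  assumes x: "bibasis_bound x M"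
    and pert: "\<And>(\<alpha> :: nat \<Rightarrow> real) m.
      (\<Sum>k<m. norm (\<alpha> k *\<^sub>R (x k - y k))) \<le> \<theta> * norm (\<Sum>k<m. \<alpha> k *\<^sub>R x k)"
    and \<theta>: "0 \<le> \<theta>" "\<theta> < 1"
  shows "bibasis_bound y ((M + \<theta>) / (1 - \<theta>))"
  unfolding bibasis_bound_def
proof (intro conjI allI impI)
  have M: "M \<ge> 1" using x by (simp add: bibasis_bound_def)
  then show "(M + \<theta>) / (1 - \<theta>) \<ge> 1" using \<theta> by (simp add: field_simps)
  fix \<alpha> :: "nat \<Rightarrow> real" and m :: nat assume m: "1 \<le> m"
  define X Y where "X n = (\<Sum>k<n. \<alpha> k *\<^sub>R x k)" and "Y n = (\<Sum>k<n. \<alpha> k *\<^sub>R y k)" for n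
  define Z where "Z = (\<Sum>k<m. \<bar>\<alpha> k *\<^sub>R (x k - y k)\<bar>)"
  define SX where "SX = Sup_fin ((\<lambda>n. \<bar>X n\<bar>) ` {1..m})"
  define SY where "SY = Sup_fin ((\<lambda>n. \<bar>Y n\<bar>) ` {1..m})"
  have diff: "X n - Y n = (\<Sum>k<n. \<alpha> k *\<^sub>R (x k - y k))" for n
    by (simp add: X_def Y_def scaleR_diff_right sum_subtractf)
  have Z: "norm Z \<le> \<theta> * norm (X m)"
    unfolding Z_def X_def by (rule order_trans[OF norm_sum_abs_le pert])
  \<comment> \<open>The error is absorbed on the left:
    \<open>(1 - \<theta>) * norm (X m) \<le> norm (Y m)\<close>, and \<open>1 - \<theta>\<close> is
    positive.\<close>
  have "norm (X m - Y m) \<le> \<theta> * norm (X m)"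
    unfolding diff unfolding X_def by (rule order_trans[OF norm_sum pert])
  moreover have "norm (X m) \<le> norm (Y m) + norm (X m - Y m)"
    by (rule norm_triangle_sub)
  ultimately have XY: "norm (X m) \<le> norm (Y m) / (1 - \<theta>)"
    using \<theta> by (simp add: field_simps)
  have "\<bar>Y n\<bar> \<le> SX + Z" if "n \<in> {1..m}" for n
  proof -
    have "\<bar>X n - Y n\<bar> \<le> (\<Sum>k<n. \<bar>\<alpha> k *\<^sub>R (x k - y k)\<bar>)"
      unfolding diff by (rule sum_abs)
    \<comment> \<open>Adding the remaining nonnegative terms up to \<open>m\<close> gives a bound
      that is uniform in \<open>n\<close>, so it survives the supremum.\<close>
    also have "\<dots> \<le> Z"
      unfolding Z_def using that by (intro sum_mono2) auto
    finally have "\<bar>X n - Y n\<bar> \<le> Z" .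
    moreover have "\<bar>X n\<bar> \<le> SX"
      unfolding SX_def using that by (intro Sup_fin.coboundedI) auto
    moreover have "\<bar>Y n\<bar> \<le> \<bar>X n\<bar> + \<bar>X n - Y n\<bar>"
      using abs_triangle_ineq4[of "X n" "X n - Y n"] by simp
    ultimately show ?thesis
      by (meson add_mono order_trans)
  qed
  then have "SY \<le> SX + Z"
    unfolding SY_def using m by (intro Sup_fin.boundedI) auto
  \<comment> \<open>Passing from \<open>SY \<le> SX + Z\<close> to norms requires
    \<open>0 \<le> SY\<close>, which holds since \<open>SY\<close> dominates a modulus.\<close>
  moreover have "\<bar>Y m\<bar> \<le> SY"
    unfolding SY_def using m by (intro Sup_fin.coboundedI) auto
  then have "0 \<le> SY"
    by (rule order_trans[OF abs_ge_zero])
  ultimately have "norm SY \<le> norm (SX + Z)"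
    by (intro norm_mono_nonneg)
  also have "\<dots> \<le> norm SX + norm Z"
    by (rule norm_triangle_ineq)
  also have "norm SX \<le> M * norm (X m)"
    using x m unfolding bibasis_bound_def SX_def X_def by blast
  also note Z
  also have "M * norm (X m) + \<theta> * norm (X m) = (M + \<theta>) * norm (X m)"
    by (simp add: algebra_simps)
  also have "\<dots> \<le> (M + \<theta>) * (norm (Y m) / (1 - \<theta>))"
    using M \<theta> by (intro mult_left_mono XY) auto
  finally show "norm (Sup_fin ((\<lambda>n. \<bar>\<Sum>k<n. \<alpha> k *\<^sub>R y k\<bar>) ` {1..m}))
      \<le> (M + \<theta>) / (1 - \<theta>) * norm (\<Sum>k<m. \<alpha> k *\<^sub>R y k)"
    by (simp add: SY_def Y_def)
qed

theorem theorem4p2: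
  fixes x y :: "nat \<Rightarrow> 'a::banach_lattice" and K M \<theta> :: real
  assumes "bibasic x"
    and "K = basis_constant x"
    and "M = bibasis_constant x"
    and "summable (\<lambda>k. norm (x k - y k) / norm (x k))"
    and "\<theta> = 2 * K * (\<Sum>k. norm (x k - y k) / norm (x k))"
    and "\<theta> < 1"
  shows "bibasic y \<and> bibasis_constant y \<le> (M + \<theta>) / (1 - \<theta>)"
proof -
  have nz: "x k \<noteq> 0" for k
    using assms(1) by (simp add: bibasic_def)
  have K: "basis_bound x K"
    using assms(1,2) by (simp add: basis_constant_attained bibasic_imp_schauder_basic)
  then have K1: "K \<ge> 1" by (simp add: basis_bound_def)
  have M: "bibasis_bound x M"
    using assms(1,3) by (simp add: bibasis_constant_attained)
  let ?s = "\<Sum>k. norm (x k - y k) / norm (x k)"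
  have s: "0 \<le> ?s" by (intro suminf_nonneg assms(4)) simp
  have "0 \<le> \<theta>" using K1 s assms(5) by simp
  then have bound: "bibasis_bound y ((M + \<theta>) / (1 - \<theta>))"
    using basis_bound_perturbation_le[OF K nz assms(4)] M assms(5,6)
    by (intro bibasis_bound_perturb) auto
  \<comment> \<open>If \<open>y k\<close> vanished, the \<open>k\<close>-th relative error would be
    1, forcing \<open>\<theta> \<ge> 1\<close> because \<open>2 * K \<ge> 1\<close>.\<close>
  have "y k \<noteq> 0" for k
  proof
    assume "y k = 0"
    then have "1 = (\<Sum>j\<in>{k}. norm (x j - y j) / norm (x j))"
      using nz[of k] by simp
    also have "\<dots> \<le> ?s"
      by (intro sum_le_suminf assms(4)) auto
    also have "\<dots> \<le> \<theta>"
      using K1 s mult_right_mono[of 1 "2 * K" ?s] assms(5) by simp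
    finally show False using assms(6) by simp
  qed
  with bound have "bibasic y" by (auto simp: bibasic_def)
  with bound show ?thesis by (simp add: bibasis_constant_attained(2))
qed

end
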